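(* Let $n\ge 1$ be an integer and let $L(K_n)$ be the line graph of the complete graph $K_n$ on $n$ vertices. Then $$\mathrm{tw}(L(K_n))=\mathrm{pw}(L(K_n))=\begin{cases}\left(\frac{n-1}{2}\right)\left(\frac{n-1}{2}\right)+n-2 & \text{if } n \text{ is odd},\\[2pt] \left(\frac{n-2}{2}\right)\left(\frac{n}{2}\right)+n-2 & \text{if } n \text{ is even},\end{cases}$$ where $\mathrm{tw}$ denotes treewidth and $\mathrm{pw}$ denotes pathwidth.
   Context: All graphs are finite and simple. The line graph $L(G)$ of a graph $G$ has vertex set $E(G)$, two vertices of $L(G)$ being adjacent when the corresponding (distinct) edges of $G$ share an endpoint. A tree decomposition of a graph $G$ is a pair $(T,\{A_x\subseteq V(G):x\in V(T)\})$ where $T$ is a tree (with at least one node), such that for every $v\in V(G)$ the nodes $x$ with $v\in A_x$ induce a non-empty connected subtree of $T$, and for every edge $vw\in E(G)$ some bag $A_x$ contains both $v$ and $w$. Its width is the maximum size of a bag minus $1$. The treewidth $\mathrm{tw}(G)$ is the minimum width of a tree decomposition of $G$; the pathwidth $\mathrm{pw}(G)$ is the minimum width of a tree decomposition of $G$ whose underlying tree is a path. (With this definition the graph with no vertices, which is $L(K_1)$, has treewidth and pathwidth $-1$.) *)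

theory Defs
  imports "Graph_Theory.Graph_Theory"
begin

text \<open>
  Finite simple graphs are the irreflexive symmetric digraphs of locale \<^locale>\<open>pair_graph\<close>:
  an undirected edge is represented by its two opposite arcs.
\<close>

text \<open>Edges become two-element sets here, so opposite arcs give a single vertex of the line graph.\<close>

definition line_graph :: "'a pair_pre_digraph \<Rightarrow> 'a set pair_pre_digraph" where
  "line_graph G =
    (let E = {{u, v} | u v. (u, v) \<in> parcs G}
     in \<lparr> pverts = E, parcs = {(e, f). e \<in> E \<and> f \<in> E \<and> e \<noteq> f \<and> e \<inter> f \<noteq> {}} \<rparr>)"

text \<open>
  The library's \<^const>\<open>tree\<close> forbids directed cycles, and an edge traversed back and forth is one
  of length 2. Cycles of a simple graph are the directed cycles of length at least 3.
  \<^const>\<open>connected\<close> includes non-emptiness.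
\<close>

definition is_tree :: "'a pair_pre_digraph \<Rightarrow> bool" where
  "is_tree T \<longleftrightarrow> pair_graph T \<and> connected (with_proj T) \<and>
     \<not> (\<exists>p. pre_digraph.cycle (with_proj T) p \<and> length p \<ge> 3)"

definition is_path :: "'a pair_pre_digraph \<Rightarrow> bool" where
  "is_path T \<longleftrightarrow> (\<exists>xs. xs \<noteq> [] \<and> distinct xs \<and> pverts T = set xs \<and>
     parcs T = (let E = {(xs ! i, xs ! Suc i) | i. Suc i < length xs} in E \<union> E\<inverse>))"

definition tree_decomposition ::
    "'a pair_pre_digraph \<Rightarrow> 't pair_pre_digraph \<Rightarrow> ('t \<Rightarrow> 'a set) \<Rightarrow> bool" where
  "tree_decomposition G T A \<longleftrightarrow>
     is_tree T \<and>
     (\<forall>x\<in>pverts T. A x \<subseteq> pverts G) \<and>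
     (\<forall>v\<in>pverts G. connected (induce_subgraph (with_proj T) {x \<in> pverts T. v \<in> A x})) \<and>
     (\<forall>(v, w)\<in>parcs G. \<exists>x\<in>pverts T. v \<in> A x \<and> w \<in> A x)"

definition decomposition_width :: "'t pair_pre_digraph \<Rightarrow> ('t \<Rightarrow> 'a set) \<Rightarrow> int" where
  "decomposition_width T A = int (Max ((\<lambda>x. card (A x)) ` pverts T)) - 1"

text \<open>
  Trees on natural numbers suffice for the minimum, as every finite tree is isomorphic to one.
  Widths are integers because the graph with no vertices has width \<open>-1\<close>.
\<close>

definition treewidth :: "'a pair_pre_digraph \<Rightarrow> int" where
  "treewidth G = (LEAST w. \<exists>(T :: nat pair_pre_digraph) A.
     tree_decomposition G T A \<and> w = decomposition_width T A)"

definition pathwidth :: "'a pair_pre_digraph \<Rightarrow> int" where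
  "pathwidth G = (LEAST w. \<exists>(T :: nat pair_pre_digraph) A.
     tree_decomposition G T A \<and> is_path T \<and> w = decomposition_width T A)"

end

theory Submission
  imports Defs
begin

text \<open>
  Lower bound: let \<open>m = (n - 1) div 2\<close> and fix a set \<open>W\<close> of \<open>2m + 1\<close> vertices of \<open>K\<^sub>n\<close>. In a tree
  decomposition of \<open>L(K\<^sub>n)\<close>, delete a bag \<open>A x\<close> (a set of edges) from \<open>K\<^sub>n\<close>. If a component contains
  more than \<open>m\<close> vertices of \<open>W\<close>, then the nodes whose bags meet its edge set form a subtree. Any two such
  components, also for different \<open>x\<close>, share a vertex of \<open>W\<close>, so these subtrees intersect pairwise, and by
  the Helly property some node \<open>x\<close> lies in all of them. The component of its own \<open>K\<^sub>n - A x\<close> avoids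
  \<open>A x\<close>, so all components of \<open>K\<^sub>n - A x\<close> have at most \<open>m\<close> vertices in \<open>W\<close>. As \<open>A x\<close> contains every
  edge between different components, it is large. Upper bound: put the vertices on a path and let every
  edge occupy the interval between its ends.
\<close>

section \<open>Connected vertex sets\<close>

text \<open>For symmetric \<open>r\<close> this is connectedness of the subgraph induced on
  \<open>S\<close>: \<open>rtrancl_on S r\<close> keeps walks inside \<open>S\<close>, so no
  subgraph has to be formed in the tree arguments.\<close>

definition conn :: "('t \<times> 't) set \<Rightarrow> 't set \<Rightarrow> bool" where
  "conn r S \<longleftrightarrow> S \<noteq> {} \<and> (\<forall>x\<in>S. \<forall>y\<in>S. (x, y) \<in> rtrancl_on S r)"

lemma conn_singleton: "conn r {x}"
  by (auto simp: conn_def)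

lemma conn_rootI:
  assumes "sym r" "x \<in> S" and root: "\<And>y. y \<in> S \<Longrightarrow> (x, y) \<in> rtrancl_on S r"
  shows "conn r S"
  unfolding conn_def
proof (intro conjI ballI)
  fix a b assume "a \<in> S" "b \<in> S"
  then show "(a, b) \<in> rtrancl_on S r"
    using root rtrancl_on_sym[OF \<open>sym r\<close>, of S] by (metis rtrancl_on_trans symD)
qed (use \<open>x \<in> S\<close> in auto)

lemma conn_insert:
  assumes "sym r" "conn r S" "u \<in> S" "(u, l) \<in> r"
  shows "conn r (insert l S)"
proof (rule conn_rootI[OF \<open>sym r\<close>])
  show "u \<in> insert l S"
    using assms by simp
  fix y assume y: "y \<in> insert l S"
  have *: "(u, y) \<in> rtrancl_on (insert l S) r" if "y \<in> S"
    using that assms(2,3) rtrancl_on_mono[OF order_refl subset_insertI] by (metis conn_def)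
  moreover have "(u, l) \<in> rtrancl_on (insert l S) r"
    using assms by (auto intro!: rtrancl_on_into_rtrancl_on[of u u])
  ultimately show "(u, y) \<in> rtrancl_on (insert l S) r"
    using y by auto
qed

lemma rtrancl_on_crossing:
  assumes "(x, y) \<in> rtrancl_on F r" "x \<in> S" "y \<notin> S"
  obtains a b where "a \<in> S" "b \<in> F - S" "(a, b) \<in> r"
proof -
  have "y \<in> S \<or> (\<exists>a b. a \<in> S \<and> b \<in> F - S \<and> (a, b) \<in> r)"
    using assms(1,2) by (induct rule: rtrancl_on_induct) auto
  then show ?thesis
    using assms(3) that by auto
qed

text \<open>Symmetrising changes nothing when the arcs are already symmetric, and restricting the
  arcs to \<open>S\<close> is what \<open>rtrancl_on S\<close> does anyway.\<close>

lemma connected_induce_subgraph_iff: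
  assumes "sym (parcs T)"
  shows "connected (induce_subgraph (with_proj T) S) \<longleftrightarrow> conn (parcs T) S"
proof -
  let ?H = "mk_symmetric (induce_subgraph (with_proj T) S)"
  have "parcs ?H = {(a, b) \<in> parcs T. a \<in> S \<and> b \<in> S}"
    using assms by (auto simp: parcs_mk_symmetric dest: symD)
  moreover have "(x, y) \<in> rtrancl_on S {(a, b) \<in> parcs T. a \<in> S \<and> b \<in> S}
      \<longleftrightarrow> (x, y) \<in> rtrancl_on S (parcs T)" for x y
  proof (rule iffI)
    assume "(x, y) \<in> rtrancl_on S {(a, b) \<in> parcs T. a \<in> S \<and> b \<in> S}"
    then show "(x, y) \<in> rtrancl_on S (parcs T)"
      by (rule rtrancl_on_mono[rotated 2]) auto
  next
    assume "(x, y) \<in> rtrancl_on S (parcs T)"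
    then show "(x, y) \<in> rtrancl_on S {(a, b) \<in> parcs T. a \<in> S \<and> b \<in> S}"
      by (induct rule: rtrancl_on_induct) (auto intro: rtrancl_on_into_rtrancl_on)
  qed
  ultimately show ?thesis
    by (auto simp: connected_def strongly_connected_def conn_def reachable_def)
qed

lemma connected_with_proj_iff:
  assumes "pair_graph T"
  shows "connected (with_proj T) \<longleftrightarrow> conn (parcs T) (pverts T)"
proof -
  interpret pair_graph T by fact
  have "sym (parcs T)"
    by (auto intro!: symI arcs_symmetric)
  moreover have "induce_subgraph (with_proj T) (pverts T) = with_proj T"
    by (auto simp: induce_subgraph_def with_proj_def dest: wellformed')
  ultimately show ?thesis
    using connected_induce_subgraph_iff[of T "pverts T"] by simp
qed

section \<open>Subtrees of a tree have the Helly property\<close>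

text \<open>The reverse of stripping leaves off a tree: a new node \<open>l\<close> has no neighbour
  in \<open>P\<close> other than \<open>u\<close>. This supplies the induction principle for
  trees.\<close>

inductive leafwise :: "('t \<times> 't) set \<Rightarrow> 't set \<Rightarrow> bool" for r where
  single: "leafwise r {x}"
| leaf: "leafwise r P \<Longrightarrow> l \<notin> P \<Longrightarrow> u \<in> P \<Longrightarrow> (\<And>y. y \<in> P \<Longrightarrow> (l, y) \<in> r \<Longrightarrow> y = u)
    \<Longrightarrow> leafwise r (insert l P)"

text \<open>A walk inside \<open>S\<close> can enter and leave \<open>l\<close> only through
  \<open>u\<close>, so visits to \<open>l\<close> can be cut out of it.\<close>

lemma conn_remove_leaf:
  assumes "sym r" and S: "conn r S" "S \<subseteq> insert l P" "l \<in> S" "S \<noteq> {l}" and "l \<notin> P"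
    and leaf: "\<And>y. y \<in> P \<Longrightarrow> (l, y) \<in> r \<Longrightarrow> y = u"
  shows "u \<in> S \<and> conn r (S - {l})"
proof -
  obtain x where x: "x \<in> S" "x \<noteq> l"
    using S by auto
  have nb: "y = u" if "y \<in> S" "y \<noteq> l" "(l, y) \<in> r \<or> (y, l) \<in> r" for y
    using that S leaf \<open>sym r\<close> by (auto dest: symD)
  \<comment> \<open>While the walk sits at \<open>l\<close>, the invariant remembers that
    \<open>u\<close> was reached without \<open>l\<close>; the walk can then resume from
    \<open>u\<close>.\<close>
  have *: "(z \<noteq> l \<longrightarrow> (x, z) \<in> rtrancl_on (S - {l}) r)
      \<and> (z = l \<longrightarrow> u \<in> S \<and> (x, u) \<in> rtrancl_on (S - {l}) r)" if "(x, z) \<in> rtrancl_on S r" for z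
    using that
  proof (induct rule: rtrancl_on_induct)
    case base
    then show ?case using x by auto
  next
    case (step y z)
    consider "y = l" "z = l" | "y = l" "z \<noteq> l" | "y \<noteq> l" "z = l" | "y \<noteq> l" "z \<noteq> l" by blast
    then show ?case
    proof cases
      case 2
      then show ?thesis using step nb[of z] by auto
    next
      case 3
      then show ?thesis using step nb[of y] by auto
    next
      case 4
      then show ?thesis using step by (auto intro: rtrancl_on_into_rtrancl_on)
    qed (use step in auto)
  qed
  have reach: "(x, z) \<in> rtrancl_on S r" if "z \<in> S" for z
    using S(1) x that by (auto simp: conn_def)
  show ?thesis
    using *[OF reach[OF \<open>l \<in> S\<close>]] * reach x by (auto intro!: conn_rootI[OF \<open>sym r\<close>, of x])
qed

text \<open>Induction on the last leaf \<open>l\<close>. If \<open>{l}\<close> is a member, all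
  members contain \<open>l\<close>. Otherwise delete \<open>l\<close> from every member: the sets
  stay connected, and two sets that met in \<open>l\<close> both contain its neighbour
  \<open>u\<close>, so they still meet.\<close>

lemma leafwise_Helly:
  assumes "leafwise r P" "sym r"
    and "\<And>S. S \<in> F \<Longrightarrow> S \<subseteq> P \<and> conn r S"
    and "\<And>S S'. S \<in> F \<Longrightarrow> S' \<in> F \<Longrightarrow> S \<inter> S' \<noteq> {}"
  shows "\<exists>x\<in>P. \<forall>S\<in>F. x \<in> S"
  using assms(1,3,4)
proof (induct arbitrary: F rule: leafwise.induct)
  case (single x)
  then show ?case by blast
next
  case (leaf P l u)
  show ?case
  proof (cases "{l} \<in> F")
    case True
    then show ?thesis using leaf.prems(2) by blast
  next
    case False
    have cut: "u \<in> S \<and> conn r (S - {l})" if "S \<in> F" "l \<in> S" for S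
      using that leaf.prems(1)[of S] False leaf.hyps
      by (intro conn_remove_leaf[OF \<open>sym r\<close>, of S l P u]) auto
    have "u \<noteq> l"
      using leaf.hyps by auto
    have "\<exists>x\<in>P. \<forall>S\<in>(\<lambda>S. S - {l}) ` F. x \<in> S"
    proof (rule leaf.hyps(2))
      fix S assume "S \<in> (\<lambda>S. S - {l}) ` F"
      then obtain S0 where S0: "S0 \<in> F" "S = S0 - {l}" by auto
      then show "S \<subseteq> P \<and> conn r S"
        using leaf.prems(1)[of S0] cut[of S0] by (cases "l \<in> S0") auto
    next
      fix S S' assume "S \<in> (\<lambda>S. S - {l}) ` F" "S' \<in> (\<lambda>S. S - {l}) ` F"
      then obtain S0 S1 where S: "S0 \<in> F" "S = S0 - {l}" "S1 \<in> F" "S' = S1 - {l}" by auto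
      then obtain y where y: "y \<in> S0" "y \<in> S1"
        using leaf.prems(2) by blast
      show "S \<inter> S' \<noteq> {}"
        using S y cut[of S0] cut[of S1] \<open>u \<noteq> l\<close> by (cases "y = l") auto
    qed
    then show ?thesis by auto
  qed
qed

lemma pcas_append: "pcas u (p @ q) w \<longleftrightarrow> (\<exists>v. pcas u p v \<and> pcas v q w)"
  by (induct p arbitrary: u) auto

lemma pawalk_verts_snoc: "pawalk_verts u (p @ [e]) = map fst (p @ [e]) @ [snd e]"
  by (induct p arbitrary: u) auto

lemma pawalk_verts_pcas: "pcas u p v \<Longrightarrow> pawalk_verts u p = map fst p @ [v]"
  by (induct p arbitrary: u) auto

text \<open>Take a maximal connected leafwise set \<open>S\<close> of nodes. If it misses a node,
  some arc leaves \<open>S\<close> towards a node \<open>l\<close>; a second neighbour of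
  \<open>l\<close> in \<open>S\<close> would close a cycle, so \<open>l\<close> is a leaf over
  \<open>S\<close>, against maximality.\<close>

lemma leafwise_tree:
  assumes "is_tree T"
  shows "leafwise (parcs T) (pverts T)"
proof -
  have pg: "pair_graph T"
    using assms by (simp add: is_tree_def)
  interpret pair_graph T by fact
  let ?r = "parcs T"
  have sym: "sym ?r"
    by (auto intro!: symI arcs_symmetric)
  have conn: "conn ?r (pverts T)"
    using assms connected_with_proj_iff[OF pg] by (simp add: is_tree_def)
  then obtain x where "x \<in> pverts T"
    by (auto simp: conn_def)
  define Q where "Q = {S. S \<subseteq> pverts T \<and> leafwise ?r S \<and> conn ?r S}"
  have "finite Q" "{x} \<in> Q"
    using \<open>x \<in> pverts T\<close> pair_finite_verts
    by (auto simp: Q_def leafwise.single conn_singleton)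
  then obtain S where S: "S \<in> Q" and max: "\<And>S'. S' \<in> Q \<Longrightarrow> S \<subseteq> S' \<Longrightarrow> S = S'"
    using finite_has_maximal[of Q] by auto
  have "S = pverts T"
  proof (rule ccontr)
    assume "S \<noteq> pverts T"
    moreover obtain z where "z \<in> S" using S by (auto simp: Q_def conn_def)
    ultimately obtain y where y: "y \<in> pverts T" "y \<notin> S" "z \<in> pverts T"
      using S by (auto simp: Q_def)
    then have "(z, y) \<in> rtrancl_on (pverts T) ?r"
      using conn by (auto simp: conn_def)
    then obtain u l where ul: "u \<in> S" "l \<in> pverts T - S" "(u, l) \<in> ?r"
      using \<open>z \<in> S\<close> \<open>y \<notin> S\<close> by (rule rtrancl_on_crossing)
    have "v = u" if v: "v \<in> S" "(l, v) \<in> ?r" for v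
    proof (rule ccontr)
      assume "v \<noteq> u"
      \<comment> \<open>The subgraph induced on \<open>S\<close> yields a walk from \<open>u\<close>
        to \<open>v\<close> with distinct vertices that avoids \<open>l\<close>; the detour through
        \<open>l\<close> then closes it to a genuine cycle. As \<open>u\<close> and \<open>v\<close>
        differ, its length is at least 3.\<close>
      let ?H = "\<lparr>pverts = S, parcs = {(a, b) \<in> ?r. a \<in> S \<and> b \<in> S}\<rparr>"
      interpret H: pair_wf_digraph ?H
        by unfold_locales auto
      have "(u, v) \<in> rtrancl_on S ?r"
        using S ul v by (auto simp: Q_def conn_def)
      then have "(u, v) \<in> rtrancl_on S (parcs ?H)"
        by (induct rule: rtrancl_on_induct) (auto intro: rtrancl_on_into_rtrancl_on ul)
      then have "reachable (with_proj ?H) u v"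
        by (simp add: reachable_def)
      then obtain p where p: "H.apath u p v"
        using H.reachable_apath by blast
      then have p': "set p \<subseteq> parcs ?H" "pcas u p v" "distinct (pawalk_verts u p)"
        by (auto simp: H.apath_def H.awalk_def)
      then have "p \<noteq> []"
        using \<open>v \<noteq> u\<close> by auto
      let ?c = "(l, u) # p @ [(v, l)]"
      have "fst ` set p \<subseteq> S"
        using p'(1) by auto
      then have "awalk l ?c l \<and> distinct (tl (pawalk_verts l ?c))"
        using p' ul v sym pawalk_verts_pcas[OF p'(2)]
        by (auto simp: awalk_def pcas_append pawalk_verts_snoc dest: symD)
      then have "cycle ?c"
        unfolding cycle_def by blast
      moreover have "length ?c \<ge> 3"
        using \<open>p \<noteq> []\<close> by (cases p) auto
      ultimately show False
        using assms by (auto simp: is_tree_def)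
    qed
    then have "insert l S \<in> Q"
      using S ul sym by (auto simp: Q_def intro: leafwise.leaf conn_insert)
    then show False
      using max ul by auto
  qed
  then show ?thesis
    using S by (auto simp: Q_def)
qed

lemma tree_Helly:
  assumes "is_tree T"
    and "\<And>S. S \<in> F \<Longrightarrow> S \<subseteq> pverts T \<and> conn (parcs T) S"
    and "\<And>S S'. S \<in> F \<Longrightarrow> S' \<in> F \<Longrightarrow> S \<inter> S' \<noteq> {}"
  shows "\<exists>x\<in>pverts T. \<forall>S\<in>F. x \<in> S"
proof -
  interpret pair_graph T
    using assms by (simp add: is_tree_def)
  have "sym (parcs T)"
    by (auto intro!: symI arcs_symmetric)
  then show ?thesis
    using leafwise_Helly[OF leafwise_tree[OF assms(1)]] assms(2,3) by blast
qed

section \<open>Balanced separators of the line graph\<close>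

lemma parcs_line_graph:
  "parcs (line_graph G) = {(e, f). e \<in> pverts (line_graph G) \<and> f \<in> pverts (line_graph G) \<and> e \<noteq> f \<and> e \<inter> f \<noteq> {}}"
  and pverts_line_graph: "pverts (line_graph G) = {{u, v} | u v. (u, v) \<in> parcs G}"
  by (simp_all add: line_graph_def Let_def)

lemma line_graph_balanced_bag:
  assumes "pair_graph G" and dec: "tree_decomposition (line_graph G) T A"
    and "finite W" "card W \<le> 2 * m + 1" "m \<ge> 1"
  shows "\<exists>x\<in>pverts T. \<forall>v. card (W \<inter> {(a, b) \<in> parcs G. {a, b} \<notin> A x}\<^sup>* `` {v}) \<le> m"
proof (rule ccontr)
  assume not_bal: "\<not> ?thesis"
  interpret G: pair_graph G by fact
  have "is_tree T"
    using dec by (simp add: tree_decomposition_def)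
  then interpret T: pair_graph T
    by (simp add: is_tree_def)
  let ?r = "parcs T"
  let ?E = "pverts (line_graph G)"
  have sym: "sym ?r"
    by (auto intro!: symI T.arcs_symmetric)
  \<comment> \<open>\<open>R x\<close> is the graph without the edges in the bag of
    \<open>x\<close>, and \<open>C x v\<close> is the component of \<open>v\<close> there.
    \<open>sub e\<close> is the subtree of nodes whose bags hold \<open>e\<close>,
    \<open>B x v\<close> the edge set of the component, and \<open>U x v\<close> the nodes whose
    bags meet \<open>B x v\<close>.\<close>
  define R where "R x = {(a, b) \<in> parcs G. {a, b} \<notin> A x}" for x
  define C where "C x v = (R x)\<^sup>* `` {v}" for x v
  define big where "big x v \<longleftrightarrow> m < card (W \<inter> C x v)" for x v
  define sub where "sub e = {y \<in> pverts T. e \<in> A y}" for e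
  define B where "B x v = {e. e \<notin> A x \<and> (\<exists>a b. (a, b) \<in> parcs G \<and> e = {a, b} \<and> a \<in> C x v)}" for x v
  define U where "U x v = (\<Union>e\<in>B x v. sub e)" for x v
  have R_sym: "(b, a) \<in> R x" if "(a, b) \<in> R x" for a b x
    using that G.arcs_symmetric by (auto simp: R_def insert_commute)
  have sub_conn: "conn ?r (sub e)" if "e \<in> ?E" for e
    using dec that connected_induce_subgraph_iff[OF sym]
    by (auto simp: tree_decomposition_def sub_def)
  have sub_meet: "sub e \<inter> sub f \<noteq> {}" if ef: "e \<in> ?E" "f \<in> ?E" "e \<inter> f \<noteq> {}" for e f
  proof (cases "e = f")
    case True
    then show ?thesis using sub_conn[of e] ef by (simp add: conn_def)
  next
    case False
    then have "(e, f) \<in> parcs (line_graph G)"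
      using ef by (auto simp: parcs_line_graph)
    then show ?thesis
      using dec by (fastforce simp: tree_decomposition_def sub_def)
  qed
  have BE: "B x v \<subseteq> ?E" for x v
    by (auto simp: B_def pverts_line_graph)
  have R_B: "{a, b} \<in> B x v" if "(a, b) \<in> R x" "a \<in> C x v" for a b x v
    using that by (auto simp: R_def B_def)
  \<comment> \<open>Here \<open>m \<ge> 1\<close> enters: a big component has at least two vertices
    of \<open>W\<close>, so it has edges and \<open>U x v\<close> is not empty.\<close>
  have start: "\<exists>w. (v, w) \<in> R x" if "big x v" for x v
  proof -
    have "\<not> W \<inter> C x v \<subseteq> {v}"
      using that \<open>m \<ge> 1\<close> card_mono[of "{v}" "W \<inter> C x v"] by (auto simp: big_def)
    then obtain w where "(v, w) \<in> (R x)\<^sup>*" "w \<noteq> v"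
      by (auto simp: C_def)
    then show ?thesis
      by (metis converse_rtranclE)
  qed
  have cover: "\<exists>e\<in>B x v. w \<in> e" if "big x v" "w \<in> C x v" for x v w
  proof -
    have "\<exists>u. (w, u) \<in> R x"
    proof (cases "w = v")
      case False
      then show ?thesis
        using \<open>w \<in> C x v\<close> R_sym by (metis C_def Image_singleton_iff rtranclE)
    qed (use start \<open>big x v\<close> in auto)
    then show ?thesis
      using R_B \<open>w \<in> C x v\<close> by blast
  qed
  \<comment> \<open>Edges sharing an endpoint have intersecting subtrees, so connectedness spreads
    from the subtree of one edge at \<open>v\<close> along walks of the component.\<close>
  have U_conn: "conn ?r (U x v)" if "big x v" for x v
  proof -
    obtain w where w: "(v, w) \<in> R x"
      using start \<open>big x v\<close> by blast
    then have e0: "{v, w} \<in> B x v"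
      by (intro R_B) (auto simp: C_def)
    then obtain y0 where y0: "y0 \<in> sub {v, w}"
      using BE sub_conn by (force simp: conn_def)
    let ?reach = "\<lambda>e. \<forall>y\<in>sub e. (y0, y) \<in> rtrancl_on (U x v) ?r"
    have inside: "(y, z) \<in> rtrancl_on (U x v) ?r" if "e \<in> B x v" "y \<in> sub e" "z \<in> sub e" for e y z
    proof (rule rtrancl_on_mono[OF order_refl])
      show "(y, z) \<in> rtrancl_on (sub e) ?r"
        using sub_conn[of e] BE that by (auto simp: conn_def)
    qed (use that in \<open>auto simp: U_def\<close>)
    have spread: "?reach f" if ef: "e \<in> B x v" "f \<in> B x v" "e \<inter> f \<noteq> {}" "?reach e" for e f
    proof -
      obtain z where "z \<in> sub e" "z \<in> sub f"
        using sub_meet[of e f] BE ef by blast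
      then show ?thesis
        using ef inside by (meson rtrancl_on_trans)
    qed
    have "\<forall>e\<in>B x v. u \<in> e \<longrightarrow> ?reach e" if "(v, u) \<in> (R x)\<^sup>*" for u
      using that
    proof (induct rule: rtrancl_induct)
      case base
      have "?reach {v, w}"
        using inside[OF e0 y0] by blast
      then show ?case
        using spread[OF e0] by blast
    next
      case (step u u')
      then have f: "{u, u'} \<in> B x v"
        by (intro R_B) (auto simp: C_def)
      then have "?reach {u, u'}"
        using step by blast
      then show ?case
        using spread[OF f] by blast
    qed
    then have "?reach e" if "e \<in> B x v" for e
      using that by (auto simp: B_def C_def)
    then show ?thesis
      using y0 e0 by (intro conn_rootI[OF sym, of y0]) (auto simp: U_def)
  qed
  define F where "F = {U x v | x v. x \<in> pverts T \<and> big x v}"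
  have "\<exists>y\<in>pverts T. \<forall>S\<in>F. y \<in> S"
  proof (rule tree_Helly[OF \<open>is_tree T\<close>])
    fix S assume "S \<in> F"
    then show "S \<subseteq> pverts T \<and> conn ?r S"
      using U_conn by (auto simp: F_def U_def sub_def)
  next
    fix S S' assume "S \<in> F" "S' \<in> F"
    then obtain x v x' v' where S: "S = U x v" "big x v" "S' = U x' v'" "big x' v'"
      by (auto simp: F_def)
    \<comment> \<open>Two disjoint subsets of \<open>W\<close> with more than \<open>m\<close>
      elements each would need \<open>2 * m + 2\<close> elements.\<close>
    have "W \<inter> C x v \<inter> (W \<inter> C x' v') \<noteq> {}"
    proof
      assume "W \<inter> C x v \<inter> (W \<inter> C x' v') = {}"
      then have "card (W \<inter> C x v) + card (W \<inter> C x' v') = card (W \<inter> C x v \<union> W \<inter> C x' v')"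
        using \<open>finite W\<close> by (intro card_Un_disjoint[symmetric]) auto
      also have "\<dots> \<le> card W"
        using \<open>finite W\<close> by (intro card_mono) auto
      finally show False
        using S \<open>card W \<le> 2 * m + 1\<close> by (simp add: big_def)
    qed
    then obtain w where "w \<in> C x v" "w \<in> C x' v'"
      by auto
    then obtain e f where "e \<in> B x v" "f \<in> B x' v'" "w \<in> e" "w \<in> f"
      using cover S by meson
    then have "sub e \<inter> sub f \<noteq> {}"
      using BE by (intro sub_meet) auto
    then show "S \<inter> S' \<noteq> {}"
      using S \<open>e \<in> B x v\<close> \<open>f \<in> B x' v'\<close> by (auto simp: U_def)
  qed
  then obtain y where y: "y \<in> pverts T" "\<And>S. S \<in> F \<Longrightarrow> y \<in> S"
    by auto
  moreover obtain v where "big y v"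
    using not_bal y(1) by (force simp: big_def C_def R_def not_le)
  \<comment> \<open>The common node \<open>y\<close> belongs to the subtree of a big component of
    its own graph \<open>R y\<close>, so the bag \<open>A y\<close> holds an edge of
    \<open>B y v\<close>, whose edges avoid \<open>A y\<close> by definition.\<close>
  ultimately have "y \<in> U y v"
    by (auto simp: F_def)
  then show False
    by (auto simp: U_def B_def sub_def)
qed

section \<open>Counting separated pairs\<close>

text \<open>The extremal class sizes are \<open>m\<close>, \<open>m\<close> and 1. If no class has
  size \<open>m\<close>, bounding every class by \<open>m - 1\<close> suffices. Otherwise split off
  a class of size \<open>m\<close>, then one of size \<open>p\<close>, and treat the remaining
  \<open>q\<close> elements as a single class, which can only add pairs.\<close>

lemma card_same_class_le:
  fixes W :: "'a set"
  assumes "finite W" "card W = 2 * m + 1"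
    and small: "\<And>w. w \<in> W \<Longrightarrow> card {x \<in> W. f x = f w} \<le> m"
  shows "card {(x, y) \<in> W \<times> W. f x = f y} \<le> 2 * m\<^sup>2 + 1"
proof -
  let ?cl = "\<lambda>w. {x \<in> W. f x = f w}"
  let ?S = "{(x, y) \<in> W \<times> W. f x = f y}"
  have "?S = (SIGMA x:W. ?cl x)"
    by auto
  then have S_sum: "card ?S = (\<Sum>x\<in>W. card (?cl x))"
    using \<open>finite W\<close> by simp
  show ?thesis
  proof (cases "\<exists>u\<in>W. card (?cl u) = m")
    case False
    then have "card (?cl x) \<le> m - 1" if "x \<in> W" for x
    proof -
      have "card (?cl x) \<noteq> m"
        using False that by blast
      then show ?thesis
        using small[OF that] by linarith
    qed
    then have "card ?S \<le> (2 * m + 1) * (m - 1)"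
      using sum_bounded_above[of W "\<lambda>x. card (?cl x)" "m - 1"] assms(2) S_sum by simp
    also have "\<dots> \<le> 2 * m\<^sup>2 + 1"
      by (cases m) (auto simp: power2_eq_square algebra_simps)
    finally show ?thesis .
  next
    case True
    then obtain u where u: "u \<in> W" "card (?cl u) = m" by blast
    have rest: "card (W - ?cl u) = m + 1"
      using u assms by (subst card_Diff_subset) auto
    then obtain u' where u': "u' \<in> W" "f u' \<noteq> f u"
    proof -
      have "W - ?cl u \<noteq> {}"
        using rest by (metis Suc_eq_plus1 card.empty nat.distinct(1))
      then show ?thesis
        using that by auto
    qed
    define p where "p = card (?cl u')"
    define q where "q = card (W - ?cl u - ?cl u')"
    have "p \<ge> 1" "p \<le> m"
      using u' small \<open>finite W\<close> by (auto simp: p_def Suc_le_eq card_gt_0_iff)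
    have "?cl u' \<subseteq> W - ?cl u"
      using u' by auto
    then have "p + q = m + 1"
      using rest card_Diff_subset[of "?cl u'" "W - ?cl u"] card_mono[of "W - ?cl u" "?cl u'"] \<open>finite W\<close>
      by (auto simp: p_def q_def)
    let ?D = "W - ?cl u - ?cl u'"
    have "?S \<subseteq> ?cl u \<times> ?cl u \<union> (?cl u' \<times> ?cl u' \<union> ?D \<times> ?D)"
      by auto
    then have "card ?S \<le> card (?cl u \<times> ?cl u \<union> (?cl u' \<times> ?cl u' \<union> ?D \<times> ?D))"
      using \<open>finite W\<close> by (intro card_mono) auto
    also have "\<dots> \<le> card (?cl u \<times> ?cl u) + (card (?cl u' \<times> ?cl u') + card (?D \<times> ?D))"
      by (intro order_trans[OF card_Un_le] add_left_mono card_Un_le)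
    also have "\<dots> = m * m + (p * p + q * q)"
      by (simp add: card_cartesian_product u p_def q_def)
    also have "p * p + q * q \<le> m * m + 1"
    proof -
      \<comment> \<open>With \<open>p + q = m + 1\<close>, twice this product is exactly
        \<open>m * m + 1 - (p * p + q * q)\<close>.\<close>
      have "0 \<le> (int p - 1) * (int m - int p)"
        using \<open>p \<ge> 1\<close> \<open>p \<le> m\<close> by simp
      moreover have q: "int q = int m + 1 - int p"
        using \<open>p + q = m + 1\<close> by simp
      ultimately have "int p * int p + int q * int q \<le> int m * int m + 1"
        unfolding q by (simp add: algebra_simps)
      then show ?thesis
        by (metis of_nat_1 of_nat_add of_nat_le_iff of_nat_mult)
    qed
    finally show ?thesis
      by (simp add: power2_eq_square)
  qed
qed

text \<open>Each unordered pair arises from at most two ordered ones.\<close>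

lemma card_ordered_pairs_le:
  assumes "finite B" "\<And>a b. (a, b) \<in> P \<Longrightarrow> {a, b} \<in> B"
  shows "card P \<le> 2 * card B"
proof -
  let ?fib = "\<lambda>e. {(a, b). {a, b} = e}"
  have fib: "finite (?fib e) \<and> card (?fib e) \<le> 2" for e :: "'a set"
  proof (cases "\<exists>a b. e = {a, b}")
    case True
    then obtain a b where "e = {a, b}" by auto
    then have fib_sub: "?fib e \<subseteq> {(a, b), (b, a)}"
      by (auto simp: doubleton_eq_iff)
    then have "card (?fib e) \<le> card {(a, b), (b, a)}"
      by (intro card_mono) simp_all
    moreover have "card {(a, b), (b, a)} \<le> 2"
      using card_length[of "[(a, b), (b, a)]"] by simp
    ultimately show ?thesis
      using finite_subset[OF fib_sub] by simp
  next
    case False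
    then have "?fib e = {}"
      by auto
    then show ?thesis
      by simp
  qed
  have "P \<subseteq> (\<Union>e\<in>B. ?fib e)"
    using assms by auto
  then have "card P \<le> card (\<Union>e\<in>B. ?fib e)"
    using assms fib by (intro card_mono) auto
  also have "\<dots> \<le> (\<Sum>e\<in>B. card (?fib e))"
    using assms by (intro card_UN_le)
  also have "\<dots> \<le> (\<Sum>e\<in>B. 2)"
    using fib by (intro sum_mono) blast
  finally show ?thesis
    by simp
qed

section \<open>Lower bound for complete graphs\<close>

text \<open>In a complete graph the balanced bag contains every edge between different components.
  Of the \<open>n * n\<close> ordered pairs, diagonal included, few lie within one component; the
  others count each separated edge twice.\<close>

lemma line_graph_complete_bag_ge:
  assumes "complete_digraph n (with_proj G)" and dec: "tree_decomposition (line_graph G) T A"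
    and n: "n = 2 * m + 1 \<or> n = 2 * m + 2" and "m \<ge> 1"
  shows "\<exists>x\<in>pverts T. (if odd n then m\<^sup>2 + 2 * m else m\<^sup>2 + 3 * m + 1) \<le> card (A x)"
proof -
  let ?V = "pverts G"
  have V: "finite ?V" "card ?V = n" "parcs G = {(u, v). u \<in> ?V \<and> v \<in> ?V \<and> u \<noteq> v}"
    using assms(1) by (auto simp: complete_digraph_pair_def)
  have "pair_graph G"
    using assms(1) by (rule pair_graphI_complete)
  interpret G: pair_graph G by fact
  have "2 * m + 1 \<le> card ?V"
    using n V by auto
  then obtain W where W: "W \<subseteq> ?V" "card W = 2 * m + 1"
    by (metis obtain_subset_with_card_n)
  have "finite W"
    using W V by (auto intro: finite_subset)
  then obtain x where x: "x \<in> pverts T"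
    and bal: "\<And>v. card (W \<inter> {(a, b) \<in> parcs G. {a, b} \<notin> A x}\<^sup>* `` {v}) \<le> m"
    using line_graph_balanced_bag[OF \<open>pair_graph G\<close> dec, of W m] W \<open>m \<ge> 1\<close> by auto
  \<comment> \<open>The component \<open>f v\<close> of \<open>v\<close> serves as its class
    label.\<close>
  define R where "R = {(a, b) \<in> parcs G. {a, b} \<notin> A x}"
  define f where "f v = R\<^sup>* `` {v}" for v
  have "sym R"
    using G.arcs_symmetric by (auto simp: R_def insert_commute intro!: symI)
  have in_f: "v \<in> f v" for v
    by (auto simp: f_def)
  have sep: "{v, w} \<in> A x" if "v \<in> ?V" "w \<in> ?V" "f v \<noteq> f w" for v w
  proof (rule ccontr)
    assume "{v, w} \<notin> A x"
    then have "(v, w) \<in> R" "(w, v) \<in> R"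
      using that V(3) \<open>sym R\<close> by (auto simp: R_def insert_commute)
    then have "f v = f w"
      by (auto simp: f_def intro: converse_rtrancl_into_rtrancl)
    then show False
      using that by simp
  qed
  have small: "card {x \<in> W. f x = f w} \<le> m" for w
  proof -
    have "{x \<in> W. f x = f w} \<subseteq> W \<inter> f w"
      using in_f by auto
    then have "card {x \<in> W. f x = f w} \<le> card (W \<inter> f w)"
      using \<open>finite W\<close> by (intro card_mono) auto
    then show ?thesis
      using bal[of w] by (simp add: f_def R_def)
  qed
  let ?same = "\<lambda>X. {(v, w) \<in> X \<times> X. f v = f w}"
  let ?cross = "{(v, w) \<in> ?V \<times> ?V. f v \<noteq> f w}"
  have same_W: "card (?same W) \<le> 2 * m\<^sup>2 + 1"
    using \<open>finite W\<close> W(2) small by (rule card_same_class_le)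
  have "A x \<subseteq> pverts (line_graph G)"
    using dec x by (simp add: tree_decomposition_def)
  moreover have "pverts (line_graph G) \<subseteq> Pow ?V"
    using V(3) by (auto simp: pverts_line_graph)
  ultimately have "finite (A x)"
    using V(1) by (meson finite_Pow_iff finite_subset)
  then have cross: "card ?cross \<le> 2 * card (A x)"
    using sep by (intro card_ordered_pairs_le) auto
  have "card (?V \<times> ?V) = card (?cross \<union> ?same ?V)"
    by (rule arg_cong[of _ _ card]) auto
  then have "n * n \<le> card ?cross + card (?same ?V)"
    using card_Un_le[of ?cross "?same ?V"] V by (simp add: card_cartesian_product)
  then have total: "n * n \<le> 2 * card (A x) + card (?same ?V)"
    using cross by linarith
  show ?thesis
  proof (cases "n = 2 * m + 1")
    case True
    then have "W = ?V"
      using W V by (simp add: card_subset_eq)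
    then have "m\<^sup>2 + 2 * m \<le> card (A x)"
      using total same_W True by (simp add: power2_eq_square algebra_simps)
    then show ?thesis
      using x True by auto
  next
    case False
    then have n: "n = 2 * m + 2"
      using n by simp
    have "card (?V - W) = 1"
      using W V n \<open>finite W\<close> by (simp add: card_Diff_subset)
    then obtain v0 where v0: "?V - W = {v0}"
      by (auto simp: card_1_singleton_iff)
    \<comment> \<open>For even \<open>n\<close> one vertex \<open>v0\<close> lies outside
      \<open>W\<close>. Its component has at most \<open>m\<close> vertices in \<open>W\<close>, so
      \<open>v0\<close> adds at most \<open>2 * m + 1\<close> ordered pairs, \<open>(v0, v0)\<close>
      among them.\<close>
    let ?D = "{x \<in> W. f x = f v0}"
    have "?V = insert v0 W"
      using v0 W by auto
    then have "?same ?V \<subseteq> ?same W \<union> ({v0} \<times> ?D \<union> (?D \<times> {v0} \<union> {(v0, v0)}))"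
      by auto
    moreover have "finite (?same W)"
      using \<open>finite W\<close> by (auto intro: finite_subset[of _ "W \<times> W"])
    ultimately have "card (?same ?V) \<le> card (?same W \<union> ({v0} \<times> ?D \<union> (?D \<times> {v0} \<union> {(v0, v0)})))"
      using \<open>finite W\<close> by (intro card_mono) auto
    also have "\<dots> \<le> card (?same W) + (card ({v0} \<times> ?D) + (card (?D \<times> {v0}) + card {(v0, v0)}))"
      by (intro order_trans[OF card_Un_le] add_left_mono card_Un_le)
    also have "\<dots> \<le> 2 * m\<^sup>2 + 1 + (m + (m + 1))"
      using small[of v0] by (intro add_mono same_W) (auto simp: card_cartesian_product)
    finally have "m\<^sup>2 + 3 * m + 1 \<le> card (A x)"
      using total n by (simp add: power2_eq_square algebra_simps)
    then show ?thesis
      using x n by auto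
  qed
qed

lemma decomposition_width_ge:
  assumes "finite (pverts T)" "x \<in> pverts T"
  shows "int (card (A x)) - 1 \<le> decomposition_width T A"
proof -
  have "card (A x) \<le> Max ((\<lambda>x. card (A x)) ` pverts T)"
    using assms by (intro Max_ge) auto
  then show ?thesis
    unfolding decomposition_width_def by linarith
qed

lemma line_graph_complete_width_ge:
  assumes "n \<ge> 1" "complete_digraph n (with_proj G)" and dec: "tree_decomposition (line_graph G) T A"
  shows "(if odd n then ((int n - 1) div 2) * ((int n - 1) div 2) + int n - 2
       else ((int n - 2) div 2) * (int n div 2) + int n - 2) \<le> decomposition_width T A"
proof -
  have "is_tree T"
    using dec by (simp add: tree_decomposition_def)
  then interpret T: pair_graph T
    by (simp add: is_tree_def)
  note width = decomposition_width_ge[OF T.pair_finite_verts, of _ A]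
  define m where "m = (n - 1) div 2"
  have n: "n = 2 * m + 1 \<or> n = 2 * m + 2"
    using \<open>n \<ge> 1\<close> unfolding m_def by presburger
  show ?thesis
  proof (cases "m \<ge> 1")
    case True
    obtain x where "x \<in> pverts T"
      "(if odd n then m\<^sup>2 + 2 * m else m\<^sup>2 + 3 * m + 1) \<le> card (A x)"
      using line_graph_complete_bag_ge[OF assms(2,3) n True] by auto
    then have "int (if odd n then m\<^sup>2 + 2 * m else m\<^sup>2 + 3 * m + 1) - 1 \<le> decomposition_width T A"
      using width[of x] by linarith
    then show ?thesis
      using n by (auto simp: power2_eq_square algebra_simps)
  next
    \<comment> \<open>Now \<open>m = 0\<close>, so \<open>n\<close> is 1 or 2 and the claimed bounds
      are -1 and 0. The first holds for any bag; for \<open>n = 2\<close> some bag must contain the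
      only edge.\<close>
    case False
    obtain x0 where "x0 \<in> pverts T"
      using \<open>is_tree T\<close> connected_with_proj_iff[OF T.pair_graph] by (auto simp: is_tree_def conn_def)
    then have "-1 \<le> decomposition_width T A"
      using width[of x0] by linarith
    moreover have "0 \<le> decomposition_width T A" if "n = 2"
    proof -
      have "card (pverts G) = 2" and arcs: "parcs G = {(u, v). u \<in> pverts G \<and> v \<in> pverts G \<and> u \<noteq> v}"
        using assms(2) \<open>n = 2\<close> by (auto simp: complete_digraph_pair_def)
      then obtain a b where "pverts G = {a, b}" "a \<noteq> b"
        by (auto simp: card_2_iff)
      then have e: "{a, b} \<in> pverts (line_graph G)"
        using arcs by (auto simp: pverts_line_graph)
      have "sym (parcs T)"
        by (auto intro!: symI T.arcs_symmetric)
      then obtain y where y: "y \<in> pverts T" "{a, b} \<in> A y"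
        using dec e connected_induce_subgraph_iff[of T] by (force simp: tree_decomposition_def conn_def)
      have "pverts (line_graph G) \<subseteq> Pow (pverts G)"
        using arcs by (auto simp: pverts_line_graph)
      then have "finite (A y)"
        using dec y \<open>pverts G = {a, b}\<close> unfolding tree_decomposition_def
        by (metis finite.emptyI finite.insertI finite_Pow_iff finite_subset)
      then have "card (A y) \<ge> 1"
        using y by (auto simp: Suc_le_eq card_gt_0_iff)
      then show ?thesis
        using width[OF y(1)] by linarith
    qed
    ultimately show ?thesis
      using n False by auto
  qed
qed

section \<open>The optimal path decomposition\<close>

definition path_graph :: "nat \<Rightarrow> nat pair_pre_digraph" where
  "path_graph n = \<lparr>pverts = {..<n}, parcs = {(a, b). a < n \<and> b < n \<and> (b = Suc a \<or> a = Suc b)}\<rparr>"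

lemma path_graph_simps [simp]:
  "pverts (path_graph n) = {..<n}"
  "parcs (path_graph n) = {(a, b). a < n \<and> b < n \<and> (b = Suc a \<or> a = Suc b)}"
  by (simp_all add: path_graph_def)

lemma sym_path_graph: "sym (parcs (path_graph n))"
  by (auto intro!: symI)

lemma pair_graph_path_graph: "pair_graph (path_graph n)"
proof
  show "finite (parcs (path_graph n))"
    by (rule finite_subset[of _ "{..<n} \<times> {..<n}"]) auto
  show "symmetric (with_proj (path_graph n))"
    using sym_path_graph by (simp add: symmetric_def)
qed auto

lemma is_path_path_graph:
  assumes "n \<ge> 1"
  shows "is_path (path_graph n)"
proof -
  have "([0..<n] ! i, [0..<n] ! Suc i) = (i, Suc i)" if "Suc i < n" for i
    using that by simp
  then have "{([0..<n] ! i, [0..<n] ! Suc i) | i. Suc i < length [0..<n]} = {(i, Suc i) | i. Suc i < n}"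
    by (metis (no_types, lifting) diff_zero length_upt)
  then show ?thesis
    unfolding is_path_def
    using assms by (intro exI[of _ "[0..<n]"]) (auto simp: Let_def lessThan_atLeast0)
qed

lemma conn_path_interval:
  assumes "a \<le> b" "b < n"
  shows "conn (parcs (path_graph n)) {a..b}"
  using assms
proof (induct b rule: dec_induct)
  case base
  then show ?case by (simp add: conn_singleton)
next
  case (step b)
  then have "conn (parcs (path_graph n)) (insert (Suc b) {a..b})"
    by (intro conn_insert[OF sym_path_graph, of n _ b]) auto
  then show ?case
    using step by (simp add: atLeastAtMostSuc_conv)
qed

lemma pcas_nth:
  "pcas u p v \<Longrightarrow> i < length p \<Longrightarrow> p ! i = (pawalk_verts u p ! i, pawalk_verts u p ! Suc i)"
proof (induct p arbitrary: u i)
  case (Cons e p)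
  then show ?case
    by (cases i; cases p) auto
qed simp

text \<open>The largest vertex of a cycle has two distinct neighbours on it, both of which would have to
  be its predecessor.\<close>

lemma path_graph_no_cycle:
  assumes "pre_digraph.cycle (with_proj (path_graph n)) p"
  shows "length p < 3"
proof (rule ccontr)
  assume "\<not> length p < 3"
  interpret pair_graph "path_graph n"
    by (rule pair_graph_path_graph)
  let ?k = "length p"
  have k: "?k \<ge> 3"
    using \<open>\<not> length p < 3\<close> by simp
  obtain u where u: "pcas u p u" "set p \<subseteq> parcs (path_graph n)" "distinct (tl (pawalk_verts u p))"
    using assms unfolding cycle_def awalk_def by auto
  define x where "x i = pawalk_verts u p ! i" for i
  have verts: "pawalk_verts u p = map fst p @ [u]"
    using pawalk_verts_pcas[OF u(1)] .
  have adj: "x (Suc i) = Suc (x i) \<or> x i = Suc (x (Suc i))" if "i < ?k" for i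
  proof -
    have "p ! i \<in> parcs (path_graph n)"
      using u(2) nth_mem[OF that] by blast
    then show ?thesis
      using pcas_nth[OF u(1) that] by (auto simp: x_def)
  qed
  have "x 0 = u"
    using u(1) k by (cases p) (auto simp: x_def)
  moreover have "x ?k = u"
    by (simp add: x_def verts nth_append)
  ultimately have closed: "x 0 = x ?k"
    by simp
  \<comment> \<open>Indices start at 1 because a cycle only guarantees distinctness of the tail of
    its vertex list; index 0 repeats index \<open>?k\<close>.\<close>
  have inj: "i = j" if "i \<in> {1..?k}" "j \<in> {1..?k}" "x i = x j" for i j
  proof -
    have "tl (pawalk_verts u p) ! (i - 1) = x i" "tl (pawalk_verts u p) ! (j - 1) = x j"
      using that by (auto simp: x_def nth_tl verts)
    then have "i - 1 = j - 1"
      using that nth_eq_iff_index_eq[OF u(3), of "i - 1" "j - 1"] by (auto simp: verts)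
    then show ?thesis
      using that by auto
  qed
  have "Max (x ` {1..?k}) \<in> x ` {1..?k}"
    using k by (intro Max_in) auto
  then obtain i where i: "i \<in> {1..?k}" "x i = Max (x ` {1..?k})"
    by (metis imageE)
  then have max: "x j \<le> x i" if "j \<in> {1..?k}" for j
    using that by auto
  \<comment> \<open>The cyclic predecessor and successor of \<open>i\<close> in
    \<open>{1..?k}\<close>, which differ because \<open>?k \<ge> 3\<close>.\<close>
  define a where "a = (if i = 1 then ?k else i - 1)"
  define b where "b = (if i = ?k then 1 else i + 1)"
  have ab: "a \<in> {1..?k}" "b \<in> {1..?k}" "a \<noteq> b"
    using i k by (auto simp: a_def b_def)
  have pred: "i - 1 < ?k" and "0 < ?k"
    using i k by auto
  have "x i = Suc (x a)"
    using adj[of "i - 1", OF pred] max[OF ab(1)] i(1) closed by (auto simp: a_def split: if_splits)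
  moreover have "x i = Suc (x b)"
    using adj[of i] adj[of 0, OF \<open>0 < ?k\<close>] max[OF ab(2)] i(1) closed by (auto simp: b_def split: if_splits)
  ultimately show False
    using inj[OF ab(1,2)] ab(3) by simp
qed

lemma is_tree_path_graph:
  assumes "n \<ge> 1"
  shows "is_tree (path_graph n)"
proof -
  have "pverts (path_graph n) = {0..n - 1}"
    using assms by auto
  then have "connected (with_proj (path_graph n))"
    using assms conn_path_interval[of 0 "n - 1" n]
    by (simp add: connected_with_proj_iff[OF pair_graph_path_graph] del: path_graph_simps(2))
  then show ?thesis
    using pair_graph_path_graph path_graph_no_cycle by (fastforce simp: is_tree_def not_less)
qed

text \<open>Order the vertices as \<open>h 0, \<dots>, h (n - 1)\<close>; the edge between \<open>h a\<close> and \<open>h b\<close> occupies exactly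
  the nodes from \<open>a\<close> to \<open>b\<close>.\<close>

definition crossing_edges :: "nat \<Rightarrow> (nat \<Rightarrow> 'a) \<Rightarrow> nat \<Rightarrow> 'a set set" where
  "crossing_edges n h i = {{h a, h b} | a b. a \<le> i \<and> i \<le> b \<and> b < n \<and> a \<noteq> b}"

text \<open>There are \<open>(i + 1) * (n - i)\<close> pairs with
  \<open>a \<le> i \<le> b < n\<close>; the subtracted 1 is the pair \<open>(i, i)\<close>, which
  gives no edge.\<close>

lemma card_crossing_edges_le:
  assumes "i < n"
  shows "card (crossing_edges n h i) \<le> (i + 1) * (n - i) - 1"
proof -
  let ?P = "{..i} \<times> {i..<n} - {(i, i)}"
  have "crossing_edges n h i \<subseteq> (\<lambda>(a, b). {h a, h b}) ` ?P"
    by (auto simp: crossing_edges_def)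
  then have "card (crossing_edges n h i) \<le> card ((\<lambda>(a, b). {h a, h b}) ` ?P)"
    by (intro card_mono) auto
  also have "\<dots> \<le> card ?P"
    by (intro card_image_le) auto
  also have "\<dots> = (i + 1) * (n - i) - 1"
    using assms by (subst card_Diff_subset) (auto simp: card_cartesian_product)
  finally show ?thesis .
qed

lemma tree_decomposition_crossing_edges:
  assumes "n \<ge> 1" "complete_digraph n (with_proj G)" and h: "bij_betw h {..<n} (pverts G)"
  shows "tree_decomposition (line_graph G) (path_graph n) (crossing_edges n h)"
proof -
  have arcs: "parcs G = {(u, v). u \<in> pverts G \<and> v \<in> pverts G \<and> u \<noteq> v}"
    using assms(2) by (auto simp: complete_digraph_pair_def)
  have inj: "h a = h b \<longleftrightarrow> a = b" if "a < n" "b < n" for a b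
    using h that by (auto simp: bij_betw_def inj_on_def)
  have E: "\<exists>a b. e = {h a, h b} \<and> a < b \<and> b < n" if e: "e \<in> pverts (line_graph G)" for e
  proof -
    obtain u v where "e = {u, v}" "u \<in> pverts G" "v \<in> pverts G" "u \<noteq> v"
      using e arcs by (auto simp: pverts_line_graph)
    moreover have "h ` {..<n} = pverts G"
      using h by (simp add: bij_betw_def)
    ultimately have "u \<in> h ` {..<n}" "v \<in> h ` {..<n}"
      by simp_all
    then obtain a b where "u = h a" "a < n" "v = h b" "b < n"
      by auto
    then have ab: "e = {h a, h b}" "a < n" "b < n" "a \<noteq> b"
      using \<open>e = {u, v}\<close> \<open>u \<noteq> v\<close> by auto
    then have "e = {h b, h a}" "a < b \<or> b < a"
      by (auto simp: insert_commute)
    then show ?thesis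
      using ab by blast
  qed
  \<comment> \<open>Membership forces the smaller index to the left:
    \<open>c \<le> i \<le> d\<close> with \<open>c\<close> and \<open>d\<close> distinct gives
    \<open>c < d\<close>, and \<open>h\<close> is injective.\<close>
  have bag: "{h a, h b} \<in> crossing_edges n h i \<longleftrightarrow> a \<le> i \<and> i \<le> b" if "a < b" "b < n" for a b i
  proof
    assume "{h a, h b} \<in> crossing_edges n h i"
    then obtain c d where "{h a, h b} = {h c, h d}" "c \<le> i" "i \<le> d" "d < n" "c \<noteq> d"
      by (auto simp: crossing_edges_def)
    then show "a \<le> i \<and> i \<le> b"
      using that by (auto simp: doubleton_eq_iff inj)
  qed (use that in \<open>auto simp: crossing_edges_def\<close>)
  have "crossing_edges n h i \<subseteq> pverts (line_graph G)" for i
  proof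
    fix e assume "e \<in> crossing_edges n h i"
    then obtain a b where "e = {h a, h b}" "a < b" "b < n"
      by (fastforce simp: crossing_edges_def)
    moreover from this have "h a \<in> pverts G" "h b \<in> pverts G" "h a \<noteq> h b"
      using h inj by (auto simp: bij_betw_def)
    ultimately show "e \<in> pverts (line_graph G)"
      using arcs by (auto simp: pverts_line_graph)
  qed
  moreover have "connected (induce_subgraph (with_proj (path_graph n))
      {x \<in> pverts (path_graph n). e \<in> crossing_edges n h x})" if e: "e \<in> pverts (line_graph G)" for e
  proof -
    obtain a b where "e = {h a, h b}" "a < b" "b < n"
      using E[OF e] by blast
    then have "{x \<in> pverts (path_graph n). e \<in> crossing_edges n h x} = {a..b}"
      using bag by auto
    then show ?thesis
      using conn_path_interval[of a b n] \<open>a < b\<close> \<open>b < n\<close> connected_induce_subgraph_iff[OF sym_path_graph]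
      by simp
  qed
  moreover have "\<exists>i\<in>pverts (path_graph n). e \<in> crossing_edges n h i \<and> f \<in> crossing_edges n h i"
    if ef: "(e, f) \<in> parcs (line_graph G)" for e f
  proof -
    obtain a b c d where "e = {h a, h b}" "a < b" "b < n" "f = {h c, h d}" "c < d" "d < n"
      using ef E[of e] E[of f] by (auto simp: parcs_line_graph)
    \<comment> \<open>If the edges share the vertex \<open>h k\<close>, then \<open>k\<close> is an
      end of both intervals, and the bag at node \<open>k\<close> contains both edges.\<close>
    moreover from this obtain k where "k \<in> {a, b}" "k \<in> {c, d}"
      using ef inj by (auto simp: parcs_line_graph)
    ultimately show ?thesis
      using bag by (intro bexI[of _ k]) auto
  qed
  ultimately show ?thesis
    using is_tree_path_graph[OF \<open>n \<ge> 1\<close>] by (auto simp: tree_decomposition_def)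
qed

text \<open>The product \<open>(i + 1) * (n - i)\<close> peaks in the middle. The slack in the bound
  is \<open>(k - i)\<^sup>2\<close> for \<open>n = 2 * k + 1\<close>, and
  \<open>(k - i) * (k - i - 1)\<close> for \<open>n = 2 * k\<close>; the latter is nonnegative on
  integers.\<close>

lemma crossing_edges_width_le:
  assumes "n \<ge> 1"
  shows "decomposition_width (path_graph n) (crossing_edges n h) \<le>
    (if odd n then ((int n - 1) div 2) * ((int n - 1) div 2) + int n - 2
       else ((int n - 2) div 2) * (int n div 2) + int n - 2)" (is "_ \<le> ?w")
proof -
  have "int (card (crossing_edges n h i)) \<le> ?w + 1" if "i < n" for i
  proof -
    have ge1: "1 \<le> (i + 1) * (n - i)"
      using that by (simp add: Suc_le_eq)
    have "int (card (crossing_edges n h i)) \<le> int ((i + 1) * (n - i) - 1)"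
      using card_crossing_edges_le[OF that] by (simp only: of_nat_le_iff)
    also have "\<dots> = (int i + 1) * (int n - int i) - 1"
      by (simp only: of_nat_diff[OF ge1] of_nat_diff[OF less_imp_le[OF that]] of_nat_mult of_nat_add of_nat_1)
    also have "\<dots> \<le> ?w + 1"
    proof (cases "odd n")
      case True
      then obtain k where k: "n = 2 * k + 1"
        by (rule oddE)
      have "0 \<le> (int k - int i)\<^sup>2"
        by simp
      then show ?thesis
        by (simp add: k power2_eq_square algebra_simps)
    next
      case False
      then obtain k where k: "n = 2 * k"
        by (auto elim: evenE)
      have "(2 * int k - 2) div 2 = int k - 1"
        by simp
      moreover have "0 \<le> (int k - int i) * (int k - int i - 1)"
        by (cases "i < k") (auto simp: mult_nonneg_nonneg mult_nonpos_nonpos)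
      ultimately show ?thesis
        by (simp add: k algebra_simps)
    qed
    finally show ?thesis .
  qed
  moreover have "Max ((\<lambda>i. card (crossing_edges n h i)) ` {..<n}) \<in> (\<lambda>i. card (crossing_edges n h i)) ` {..<n}"
    using assms by (intro Max_in) (auto simp: lessThan_empty_iff)
  then obtain i where i: "i < n"
    "Max ((\<lambda>i. card (crossing_edges n h i)) ` {..<n}) = card (crossing_edges n h i)"
    by auto
  ultimately have "int (Max ((\<lambda>i. card (crossing_edges n h i)) ` {..<n})) \<le> ?w + 1"
    by simp
  then show ?thesis
    unfolding decomposition_width_def path_graph_simps by linarith
qed

theorem theorem1:
  fixes n :: nat and G :: "'a pair_pre_digraph"
  assumes "n \<ge> 1"
    and "complete_digraph n (with_proj G)"
  shows "treewidth (line_graph G) = pathwidth (line_graph G) \<and>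
    pathwidth (line_graph G) =
      (if odd n then ((int n - 1) div 2) * ((int n - 1) div 2) + int n - 2
       else ((int n - 2) div 2) * (int n div 2) + int n - 2)"
proof -
  define w where "w = (if odd n then ((int n - 1) div 2) * ((int n - 1) div 2) + int n - 2
       else ((int n - 2) div 2) * (int n div 2) + int n - 2)"
  have lower: "w \<le> decomposition_width T A"
    if "tree_decomposition (line_graph G) T A" for T :: "nat pair_pre_digraph" and A
    unfolding w_def using assms that by (rule line_graph_complete_width_ge)
  have "finite (pverts G)" "card (pverts G) = n"
    using assms(2) by (auto simp: complete_digraph_pair_def)
  then obtain h where "bij_betw h {..<n} (pverts G)"
    using ex_bij_betw_nat_finite[of "pverts G"] by (auto simp: lessThan_atLeast0)
  then have dec: "tree_decomposition (line_graph G) (path_graph n) (crossing_edges n h)"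
    using assms by (intro tree_decomposition_crossing_edges)
  then have width: "w = decomposition_width (path_graph n) (crossing_edges n h)"
    using lower[OF dec] crossing_edges_width_le[OF assms(1), of h] by (simp add: w_def)
  \<comment> \<open>\<open>lower\<close> covers every tree decomposition and a path decomposition
    attains it, so the same witness settles both minima.\<close>
  have "treewidth (line_graph G) = w"
    unfolding treewidth_def using dec width lower by (intro Least_equality) blast+
  moreover have "pathwidth (line_graph G) = w"
    unfolding pathwidth_def using dec width lower is_path_path_graph[OF assms(1)]
    by (intro Least_equality) blast+
  ultimately show ?thesis
    by (simp add: w_def)
qed

end
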